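(* Let $n\ge 1$, let $B,W\in\mathbb{R}^{n\times n}$ be row-stochastic matrices, and let $A\in\mathbb{R}^{n\times n}$ be a diagonal matrix with $0\le A\le I$ (i.e. all diagonal entries of $A$ lie in $[0,1]$). Let $(\lambda(k))_{k\ge 0}$ be an i.i.d. sequence of random vectors with values in $\{0,1\}^n$ such that, for each $i\in\{1,\dots,n\}$ and each $k$, $\lambda_i(k)=0$ with probability $p_i$ and $\lambda_i(k)=1$ with probability $1-p_i$, and such that the covariance matrix of $\lambda(k)$ is positive definite. Write $p=[p_1,\dots,p_n]^\top$. Consider the process $$x(k+1)=Bx(k)+A\big(\lambda(k)-Wx(k)\big),\qquad k\ge 0,\qquad x(0)=x_0\in\mathbb{R}^n.$$ If $B-AW$ is Schur stable and $p\in\operatorname{span}\{\mathbf{1}\}$, then the expectation of $x(k)$ converges to consensus, i.e. for every $x_0\in\mathbb{R}^n$ the limit $\lim_{k\to\infty}\mathbb{E}(x(k))$ exists and belongs to $\operatorname{span}\{\mathbf{1}\}$.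
   Context: A square matrix is row stochastic if its entries are nonnegative and each row sums to $1$. A square matrix $H$ is Schur stable if its spectral radius satisfies $\rho(H)<1$. $\mathbf{1}\in\mathbb{R}^n$ is the all-ones column vector. The initial condition $x_0$ is a deterministic vector. A vector is a consensus vector if all its components are equal, i.e. it lies in $\operatorname{span}\{\mathbf{1}\}$. *)

theory Defs
  imports "HOL-Probability.Probability"
begin

definition row_stochastic :: "real^'n^'n \<Rightarrow> bool" where
  "row_stochastic M \<longleftrightarrow> (\<forall>i j. 0 \<le> M $ i $ j) \<and> (\<forall>i. (\<Sum>j\<in>UNIV. M $ i $ j) = 1)"

definition diagonal_matrix :: "real^'n^'n \<Rightarrow> bool" where
  "diagonal_matrix M \<longleftrightarrow> (\<forall>i j. i \<noteq> j \<longrightarrow> M $ i $ j = 0)"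

text \<open>The spectrum of a real matrix is taken over the complex numbers; it is finite and nonempty,
  so that the maximum below is attained.\<close>

definition complex_spectrum :: "real^'n^'n \<Rightarrow> complex set" where
  "complex_spectrum M = {z. \<exists>v. v \<noteq> 0 \<and> map_matrix complex_of_real M *v v = z *s v}"

definition spectral_radius :: "real^'n^'n \<Rightarrow> real" where
  "spectral_radius M = Max (norm ` complex_spectrum M)"

definition schur_stable :: "real^'n^'n \<Rightarrow> bool" where
  "schur_stable M \<longleftrightarrow> spectral_radius M < 1"

definition positive_definite :: "real^'n^'n \<Rightarrow> bool" where
  "positive_definite M \<longleftrightarrow> transpose M = M \<and> (\<forall>v. v \<noteq> 0 \<longrightarrow> 0 < v \<bullet> (M *v v))"

definition covariance_matrix :: "'w measure \<Rightarrow> ('w \<Rightarrow> real^'n) \<Rightarrow> real^'n^'n" where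
  "covariance_matrix M X =
     (\<chi> i j. \<integral>\<omega>. (X \<omega> $ i - (\<integral>\<omega>'. X \<omega>' $ i \<partial>M)) * (X \<omega> $ j - (\<integral>\<omega>'. X \<omega>' $ j \<partial>M)) \<partial>M)"

text \<open>Independence includes Borel measurability of every \<open>X k\<close>.\<close>

definition iid_sequence :: "'w measure \<Rightarrow> (nat \<Rightarrow> 'w \<Rightarrow> real^'n) \<Rightarrow> bool" where
  "iid_sequence M X \<longleftrightarrow>
     prob_space.indep_vars M (\<lambda>_. borel) X UNIV \<and>
     (\<forall>k. distr M borel (X k) = distr M borel (X 0))"

primrec process ::
  "real^'n^'n \<Rightarrow> real^'n^'n \<Rightarrow> real^'n^'n \<Rightarrow> (nat \<Rightarrow> 'w \<Rightarrow> real^'n) \<Rightarrow> real^'n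
     \<Rightarrow> nat \<Rightarrow> 'w \<Rightarrow> real^'n" where
  "process A B W l x0 0 \<omega> = x0"
| "process A B W l x0 (Suc k) \<omega> =
     B *v process A B W l x0 k \<omega> + A *v (l k \<omega> - W *v process A B W l x0 k \<omega>)"

end

theory Submission
  imports Defs "HOL-Computational_Algebra.Fundamental_Theorem_Algebra"
begin

text \<open>
  Write \<open>H = B - A W\<close>, and let \<open>p\<close> be the vector with all components \<open>a\<close>. Since each
  \<open>\<lambda>\<^sub>i(k)\<close> is \<open>0/1\<close>-valued, \<open>E(\<lambda>(k))\<close> is the consensus vector \<open>c\<close> with all components \<open>1 - a\<close>,
  and by linearity the expectations satisfy the deterministic recursion
  \<open>E(x(k+1)) = H E(x(k)) + A c\<close>. Row stochasticity says that \<open>B\<close> and \<open>W\<close> fix every consensus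
  vector, so \<open>H c + A c = B c - A W c + A c = c\<close>: the vector \<open>c\<close> is a fixed point of the recursion
  and \<open>E(x(k)) - c = H\<^sup>k (x\<^sub>0 - c)\<close>. It remains to see that powers of a Schur stable matrix, applied
  to a vector, tend to zero.

  That last fact (\<open>schur_stable_power_tendsto_0\<close>) is proved without a normal form of \<open>H\<close>. Over
  the complex numbers some nonzero polynomial \<open>q\<close> satisfies \<open>q(H) v = 0\<close>, and \<open>q\<close> has a root
  \<open>z\<close>, so \<open>q = (X - z) r\<close>. If \<open>z\<close> is not an eigenvalue, then \<open>H - z\<close> is injective and already
  \<open>r(H) v = 0\<close>. If \<open>z\<close> is an eigenvalue, then \<open>|z| < 1\<close>, and \<open>y = (H - z) v\<close> satisfies
  \<open>r(H) y = 0\<close>; by induction on the degree \<open>H\<^sup>k y\<close> tends to zero, and the recursion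
  \<open>H\<^sup>k\<^sup>+\<^sup>1 v = z H\<^sup>k v + H\<^sup>k y\<close> carries this over to \<open>H\<^sup>k v\<close>
  (\<open>affine_recursion_tendsto_0\<close>). A polynomial annihilating all vectors at once also shows that the
  spectrum is finite, so that the maximum that defines the spectral radius does bound
  every eigenvalue.
\<close>

section \<open>Polynomials in a matrix, applied to a vector\<close>

text \<open>This is \<open>q(H) v\<close>. The Horner form gives a recursion along \<open>pCons\<close>, so that the algebra
  below follows by induction on polynomials.\<close>

definition poly_mat_vec :: "complex poly \<Rightarrow> complex^'n^'n \<Rightarrow> complex^'n \<Rightarrow> complex^'n" where
  "poly_mat_vec q H v = fold_coeffs (\<lambda>a w. a *s v + H *v w) q 0"

lemma poly_mat_vec_0 [simp]: "poly_mat_vec 0 H v = 0"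
  by (simp add: poly_mat_vec_def)

lemma poly_mat_vec_pCons [simp]:
  "poly_mat_vec (pCons a q) H v = a *s v + H *v poly_mat_vec q H v"
  by (cases "q = 0 \<and> a = 0") (auto simp: poly_mat_vec_def)

lemma poly_mat_vec_zero_right [simp]: "poly_mat_vec q H 0 = 0"
  by (induction q) auto

lemma poly_mat_vec_add:
  "poly_mat_vec (q + r) H v = poly_mat_vec q H v + poly_mat_vec r H v"
  by (induction q r rule: poly_induct2)
    (auto simp: matrix_vector_right_distrib vec.scale_left_distrib)

lemma poly_mat_vec_sum:
  "poly_mat_vec (\<Sum>i\<in>I. f i) H v = (\<Sum>i\<in>I. poly_mat_vec (f i) H v)"
  by (induction I rule: infinite_finite_induct) (auto simp: poly_mat_vec_add)

lemma poly_mat_vec_smult: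
  "poly_mat_vec (smult a q) H v = a *s poly_mat_vec q H v"
  by (induction q) (auto simp: vec.scale_right_distrib vector_scalar_commute)

lemma poly_mat_vec_mult:
  "poly_mat_vec (q * r) H v = poly_mat_vec q H (poly_mat_vec r H v)"
  by (induction q) (auto simp: poly_mat_vec_add poly_mat_vec_smult)

lemma poly_mat_vec_monom:
  "poly_mat_vec (monom a i) H v = a *s (((*v) H) ^^ i) v"
  by (induction i) (auto simp: monom_0 monom_Suc vector_scalar_commute)

lemma poly_mat_vec_eigenvector:
  assumes "H *v v = z *s v"
  shows "poly_mat_vec q H v = poly q z *s v"
  by (induction q)
    (auto simp: vector_scalar_commute assms vec.scale_left_distrib algebra_simps)

section \<open>Annihilating polynomials and finiteness of the spectrum\<close>

text \<open>The Krylov vectors \<open>v, H v, H\<^sup>2 v, \<dots>\<close> either repeat or form an infinite, hence linearly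
  dependent, subset of a finite-dimensional space; in both cases a nontrivial linear relation
  between them is a polynomial \<open>q\<close> with \<open>q(H) v = 0\<close>.\<close>

lemma ex_poly_annihilating_vector:
  fixes H :: "complex^'n^'n" and v :: "complex^'n"
  shows "\<exists>q. q \<noteq> 0 \<and> poly_mat_vec q H v = 0"
proof (cases "inj (\<lambda>i. (((*v) H) ^^ i) v)")
  case False
  then obtain i j where ij: "i \<noteq> j" "(((*v) H) ^^ i) v = (((*v) H) ^^ j) v"
    by (auto simp: inj_on_def)
  define q :: "complex poly" where "q = monom 1 i + monom (-1) j"
  have "coeff q i = 1"
    using ij(1) by (simp add: q_def)
  moreover have "poly_mat_vec q H v = 0"
    using ij(2) by (simp add: q_def poly_mat_vec_add poly_mat_vec_monom)
  ultimately show ?thesis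
    by (intro exI[of _ q]) auto
next
  case True
  define f where "f = (\<lambda>i. (((*v) H) ^^ i) v)"
  have inj: "inj f"
    using True by (simp add: f_def)
  then have "vec.dependent (range f)"
    using vec.finiteI_independent[of "range f"] finite_imageD[of f UNIV] by auto
  then obtain t u w where t: "finite t" "t \<subseteq> range f" "(\<Sum>x\<in>t. u x *s x) = 0"
    and w: "w \<in> t" "u w \<noteq> 0"
    unfolding vec.dependent_explicit by blast
  define I where "I = f -` t"
  have I: "finite I" "t = f ` I"
    using t inj by (auto simp: I_def intro: finite_vimageI)
  define q where "q = (\<Sum>i\<in>I. monom (u (f i)) i)"
  obtain i where i: "i \<in> I" "w = f i"
    using w I by auto
  have "coeff q i = u (f i)"
    using i I by (simp add: q_def coeff_sum coeff_monom)
  moreover have "poly_mat_vec q H v = (\<Sum>x\<in>t. u x *s x)"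
    using inj unfolding q_def I(2)
    by (subst sum.reindex)
      (auto simp: poly_mat_vec_sum poly_mat_vec_monom f_def intro: inj_on_subset)
  ultimately show ?thesis
    using t(3) w(2) i(2) by (intro exI[of _ q]) auto
qed

lemma poly_mat_vec_linear: "Vector_Spaces.linear (*s) (*s) (poly_mat_vec q H)"
proof -
  have "poly_mat_vec q H (x + y) = poly_mat_vec q H x + poly_mat_vec q H y" for x y
    by (induction q) (auto simp: matrix_vector_right_distrib vec.scale_right_distrib)
  moreover have "poly_mat_vec q H (a *s x) = a *s poly_mat_vec q H x" for a x
    by (induction q)
      (auto simp: vector_scalar_commute vec.scale_right_distrib mult.commute)
  ultimately show ?thesis
    by (intro Vector_Spaces.linear.intro vec.vector_space_axioms
        module_hom.intro module_hom_axioms.intro vec.module_axioms) auto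
qed

text \<open>Polynomials in \<open>H\<close> commute, so a product of annihilators of the unit vectors annihilates each
  unit vector and therefore, by linearity, every vector.\<close>

lemma ex_annihilating_poly:
  fixes H :: "complex^'n^'n"
  shows "\<exists>q. q \<noteq> 0 \<and> (\<forall>v. poly_mat_vec q H v = 0)"
proof -
  obtain r where r: "\<And>v. r v \<noteq> 0" "\<And>v. poly_mat_vec (r v) H v = 0"
    using ex_poly_annihilating_vector[of H] by metis
  define q where "q = (\<Prod>b\<in>(cart_basis :: (complex^'n) set). r b)"
  have fin: "finite (cart_basis :: (complex^'n) set)"
    by (rule finite_cart_basis)
  have "q \<noteq> 0"
    using r(1) fin by (simp add: q_def)
  moreover have "poly_mat_vec q H v = 0" for v
  proof (rule vec.linear_eq_0_on_span[OF poly_mat_vec_linear])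
    show "v \<in> vec.span cart_basis"
      by (simp add: vec.span_Basis)
  next
    fix b :: "complex^'n" assume b: "b \<in> cart_basis"
    have "q = (\<Prod>b\<in>cart_basis - {b}. r b) * r b"
      using prod.remove[OF fin b, of r] by (simp add: q_def mult.commute)
    then show "poly_mat_vec q H b = 0"
      by (simp add: poly_mat_vec_mult r(2))
  qed
  ultimately show ?thesis by blast
qed

text \<open>Every eigenvalue is a root of an annihilating polynomial.\<close>

lemma finite_complex_spectrum: "finite (complex_spectrum H)"
proof -
  let ?H = "map_matrix complex_of_real H"
  obtain q where q: "q \<noteq> 0" "\<And>v. poly_mat_vec q ?H v = 0"
    using ex_annihilating_poly[of ?H] by blast
  have "complex_spectrum H \<subseteq> {z. poly q z = 0}"
  proof
    fix z assume "z \<in> complex_spectrum H"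
    then obtain v where "v \<noteq> 0" "?H *v v = z *s v"
      by (auto simp: complex_spectrum_def)
    then show "z \<in> {z. poly q z = 0}"
      using q(2)[of v] by (auto simp: poly_mat_vec_eigenvector)
  qed
  then show ?thesis
    using poly_roots_finite[OF q(1)] finite_subset by blast
qed

section \<open>Powers of Schur stable matrices\<close>

text \<open>A strict contraction forgets its initial value: once the inputs \<open>w\<close> are below
  \<open>(1 - |z|) d\<close>, the iterates exceed the level \<open>d\<close> by a geometrically decaying term at most.\<close>

lemma affine_recursion_tendsto_0:
  fixes u w :: "nat \<Rightarrow> complex"
  assumes rec: "\<And>k. u (Suc k) = z * u k + w k"
    and z: "norm z < 1" and w: "w \<longlonglongrightarrow> 0"
  shows "u \<longlonglongrightarrow> 0"
proof (rule LIMSEQ_I)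
  fix e :: real assume e: "e > 0"
  define s where "s = norm z"
  have s: "0 \<le> s" "s < 1"
    using z by (auto simp: s_def)
  define d where "d = e / 2"
  have "(1 - s) * d > 0"
    using s e by (simp add: d_def)
  from LIMSEQ_D[OF w this] obtain N where N: "\<And>k. k \<ge> N \<Longrightarrow> norm (w k) < (1 - s) * d"
    by auto
  have bound: "norm (u (N + m)) \<le> s ^ m * norm (u N) + d" for m
  proof (induction m)
    case 0
    then show ?case using e by (simp add: d_def)
  next
    case (Suc m)
    have "norm (u (N + Suc m)) \<le> s * norm (u (N + m)) + norm (w (N + m))"
      using norm_triangle_ineq[of "z * u (N + m)" "w (N + m)"]
      by (simp add: rec s_def norm_mult)
    also have "\<dots> \<le> s * (s ^ m * norm (u N) + d) + (1 - s) * d"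
      using Suc N[of "N + m"] s by (intro add_mono mult_left_mono) auto
    also have "\<dots> = s ^ Suc m * norm (u N) + d"
      by (simp add: algebra_simps)
    finally show ?case .
  qed
  have "(\<lambda>m. s ^ m * norm (u N)) \<longlonglongrightarrow> 0"
    using s by (intro tendsto_mult_left_zero LIMSEQ_power_zero) auto
  moreover have "d > 0"
    using e by (simp add: d_def)
  ultimately obtain K where K: "\<And>m. m \<ge> K \<Longrightarrow> s ^ m * norm (u N) < d"
    using LIMSEQ_D by (metis abs_less_iff diff_zero real_norm_def)
  have "norm (u k - 0) < e" if "k \<ge> N + K" for k
  proof -
    have "k - N \<ge> K" "N + (k - N) = k"
      using that by auto
    then have "norm (u k) < d + d"
      using bound[of "k - N"] K[of "k - N"] by simp
    then show ?thesis by (simp add: d_def)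
  qed
  then show "\<exists>K. \<forall>k\<ge>K. norm (u k - 0) < e"
    by blast
qed

text \<open>Induction on the degree of the annihilator, stripping one linear factor \<open>X - z\<close> at a time.
  Which end of the product the factor is taken from depends on \<open>z\<close>: a factor with \<open>z\<close> an eigenvalue
  is applied to \<open>v\<close> first, any other factor last, where its injectivity lets it be cancelled.\<close>

lemma mat_power_tendsto_0:
  fixes H :: "complex^'n^'n"
  assumes stable: "\<And>z v. v \<noteq> 0 \<Longrightarrow> H *v v = z *s v \<Longrightarrow> norm z < 1"
    and "q \<noteq> 0" and "poly_mat_vec q H v = 0"
  shows "(\<lambda>k. (((*v) H) ^^ k) v) \<longlonglongrightarrow> 0"
  using assms(2,3)
proof (induction "degree q" arbitrary: q v)
  case 0
  then obtain a where "q = [:a:]" "a \<noteq> 0"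
    by (metis degree_eq_zeroE pCons_0_0)
  with 0 have "v = 0"
    by simp
  moreover have "(((*v) H) ^^ k) 0 = 0" for k
    by (induction k) auto
  ultimately show ?case by simp
next
  case (Suc d)
  then have "\<not> constant (poly q)"
    by (simp add: constant_degree)
  then obtain z where "poly q z = 0"
    using fundamental_theorem_of_algebra by blast
  then obtain r where r: "q = [:- z, 1:] * r"
    by (auto simp: poly_eq_0_iff_dvd elim: dvdE)
  have r0: "r \<noteq> 0"
    using Suc.prems r by auto
  then have deg: "d = degree r"
    using Suc.hyps(2) unfolding r by (subst (asm) degree_mult_eq) auto
  have lin: "poly_mat_vec [:- z, 1:] H y = H *v y - z *s y" for y
    by simp
  show ?case
  proof (cases "\<exists>y. y \<noteq> 0 \<and> H *v y = z *s y")
    case True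
    then have z: "norm z < 1"
      using stable by blast
    define y where "y = H *v v - z *s v"
    have "poly_mat_vec r H y = 0"
      using Suc.prems(2) unfolding y_def lin[symmetric] r
      by (simp only: mult.commute[of _ r] poly_mat_vec_mult)
    then have y: "(\<lambda>k. (((*v) H) ^^ k) y) \<longlonglongrightarrow> 0"
      by (rule Suc.hyps(1)[OF deg r0])
    have step: "(((*v) H) ^^ Suc k) v = z *s (((*v) H) ^^ k) v + (((*v) H) ^^ k) y" for k
      by (induction k) (auto simp: y_def matrix_vector_right_distrib vector_scalar_commute)
    show ?thesis
    proof (rule vec_tendstoI)
      fix i
      have "(\<lambda>k. (((*v) H) ^^ k) v $ i) \<longlonglongrightarrow> 0"
      proof (rule affine_recursion_tendsto_0[OF _ z])
        show "(((*v) H) ^^ Suc k) v $ i = z * (((*v) H) ^^ k) v $ i + (((*v) H) ^^ k) y $ i" for k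
          unfolding step by simp
        show "(\<lambda>k. (((*v) H) ^^ k) y $ i) \<longlonglongrightarrow> 0"
          using tendsto_vec_nth[OF y, of i] by simp
      qed
      then show "(\<lambda>k. (((*v) H) ^^ k) v $ i) \<longlonglongrightarrow> 0 $ i" by simp
    qed
  next
    case False
    have "H *v poly_mat_vec r H v = z *s poly_mat_vec r H v"
      using Suc.prems(2) unfolding r poly_mat_vec_mult lin by simp
    then have "poly_mat_vec r H v = 0"
      using False by blast
    then show ?thesis
      by (rule Suc.hyps(1)[OF deg r0])
  qed
qed

text \<open>The eigenvalues of a real matrix may be complex, so the real iterates are embedded into
  \<open>\<complex>\<^sup>n\<close>, where each component converges exactly when the real one does.\<close>

lemma schur_stable_power_tendsto_0:
  fixes H :: "real^'n^'n"
  assumes "schur_stable H"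
  shows "(\<lambda>k. (((*v) H) ^^ k) v) \<longlonglongrightarrow> 0"
proof -
  let ?H = "map_matrix complex_of_real H"
  define c :: "real^'n \<Rightarrow> complex^'n" where "c = (\<lambda>x. \<chi> i. complex_of_real (x $ i))"
  have stable: "norm z < 1" if "y \<noteq> 0" "?H *v y = z *s y" for z y
  proof -
    have "z \<in> complex_spectrum H"
      using that by (auto simp: complex_spectrum_def)
    then have "norm z \<le> spectral_radius H"
      unfolding spectral_radius_def by (intro Max_ge) (auto simp: finite_complex_spectrum)
    then show ?thesis
      using assms by (simp add: schur_stable_def)
  qed
  obtain q where "q \<noteq> 0" "\<And>v. poly_mat_vec q ?H v = 0"
    using ex_annihilating_poly[of ?H] by blast
  then have lim: "(\<lambda>k. (((*v) ?H) ^^ k) (c v)) \<longlonglongrightarrow> 0"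
    using mat_power_tendsto_0[of ?H q "c v"] stable by blast
  have "?H *v c x = c (H *v x)" for x
    by (simp add: c_def map_matrix_def matrix_vector_mult_def vec_eq_iff)
  then have pow: "(((*v) ?H) ^^ k) (c v) = c ((((*v) H) ^^ k) v)" for k
    by (induction k) auto
  show ?thesis
  proof (rule vec_tendstoI)
    fix i
    have "(\<lambda>k. complex_of_real ((((*v) H) ^^ k) v $ i)) \<longlonglongrightarrow> of_real 0"
      using tendsto_vec_nth[OF lim, of i] unfolding pow by (simp add: c_def)
    then show "(\<lambda>k. (((*v) H) ^^ k) v $ i) \<longlonglongrightarrow> 0 $ i"
      unfolding tendsto_of_real_iff by simp
  qed
qed

section \<open>The expectation of the process\<close>

lemma row_stochastic_mult_const:
  assumes "row_stochastic W"
  shows "W *v (a *\<^sub>R 1) = a *\<^sub>R 1"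
  using assms
  by (simp add: row_stochastic_def matrix_vector_mult_def vec_eq_iff sum_distrib_right[symmetric])

lemma (in prob_space) binary_vector_integrable_expectation:
  fixes X :: "'a \<Rightarrow> real^'n"
  assumes X [measurable]: "X \<in> borel_measurable M"
    and bin: "\<And>\<omega> i. \<omega> \<in> space M \<Longrightarrow> X \<omega> $ i \<in> {0, 1}"
  shows "integrable M X"
    and "expectation X $ i = prob {\<omega> \<in> space M. X \<omega> $ i = 1}"
proof -
  have "norm (X \<omega>) \<le> CARD('n)" if "\<omega> \<in> space M" for \<omega>
  proof -
    have "norm (X \<omega>) \<le> (\<Sum>i\<in>UNIV. \<bar>X \<omega> $ i\<bar>)"
      by (rule norm_le_l1_cart)
    also have "\<dots> \<le> (\<Sum>i\<in>(UNIV :: 'n set). 1)"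
    proof (rule sum_mono)
      show "\<bar>X \<omega> $ i\<bar> \<le> 1" for i
        using bin[OF that, of i] by auto
    qed
    finally show ?thesis by simp
  qed
  then show int: "integrable M X"
    by (intro integrable_const_bound[of _ "CARD('n)"]) auto
  have "expectation X $ i = expectation (\<lambda>\<omega>. X \<omega> $ i)"
    using integral_bounded_linear[OF bounded_linear_vec_nth int] by metis
  also have "\<dots> = expectation (indicator {\<omega> \<in> space M. X \<omega> $ i = 1})"
    using bin by (intro Bochner_Integration.integral_cong) (auto simp: indicator_def)
  also have "\<dots> = prob {\<omega> \<in> space M. X \<omega> $ i = 1}"
    by simp
  finally show "expectation X $ i = prob {\<omega> \<in> space M. X \<omega> $ i = 1}" .
qed

lemma (in prob_space) process_integrable_expectation:
  fixes A B W :: "real^'n^'n"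
  assumes int: "\<And>k. integrable M (l k)"
  shows "integrable M (process A B W l x0 k)"
    and "expectation (process A B W l x0 (Suc k)) =
      (B - A ** W) *v expectation (process A B W l x0 k) + A *v expectation (l k)"
proof -
  let ?x = "process A B W l x0"
  have rw: "?x (Suc k) = (\<lambda>\<omega>. (B - A ** W) *v ?x k \<omega> + A *v l k \<omega>)" for k
    by (simp add: fun_eq_iff matrix_vector_mult_diff_rdistrib matrix_vector_mult_diff_distrib
        matrix_vector_mul_assoc)
  have bl: "bounded_linear ((*v) H)" for H :: "real^'n^'n"
    by (rule matrix_vector_mul_bounded_linear)
  have x: "integrable M (?x k)" for k
  proof (induction k)
    case 0
    have "?x 0 = (\<lambda>_. x0)" by auto
    then show ?case by simp
  next
    case (Suc k)
    then show ?case
      unfolding rw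
      by (intro Bochner_Integration.integrable_add integrable_bounded_linear[OF bl] int)
  qed
  then show "integrable M (?x k)" .
  show "expectation (?x (Suc k)) = (B - A ** W) *v expectation (?x k) + A *v expectation (l k)"
    unfolding rw
    by (subst Bochner_Integration.integral_add)
      (auto intro!: integrable_bounded_linear[OF bl] x int simp: integral_bounded_linear[OF bl] x int)
qed

theorem corollary3:
  fixes M :: "'w measure"
    and A B W :: "real^'n^'n"
    and l :: "nat \<Rightarrow> 'w \<Rightarrow> real^'n"
    and p :: "real^'n"
  assumes "prob_space M"
    and "row_stochastic B" and "row_stochastic W"
    and "diagonal_matrix A" and "\<And>i. 0 \<le> A $ i $ i \<and> A $ i $ i \<le> 1"
    and "iid_sequence M l"
    and "\<And>k \<omega> i. \<omega> \<in> space M \<Longrightarrow> l k \<omega> $ i \<in> {0, 1}"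
    and "\<And>k i. measure M {\<omega> \<in> space M. l k \<omega> $ i = 0} = p $ i"
    and "\<And>k i. measure M {\<omega> \<in> space M. l k \<omega> $ i = 1} = 1 - p $ i"
    and "\<And>k. positive_definite (covariance_matrix M (l k))"
    and "schur_stable (B - A ** W)"
    and "p \<in> span {1}"
  shows "\<forall>x0. (\<forall>k. integrable M (process A B W l x0 k)) \<and>
    (\<exists>c \<in> span {1}. (\<lambda>k. \<integral>\<omega>. process A B W l x0 k \<omega> \<partial>M) \<longlonglongrightarrow> c)"
proof -
  interpret prob_space M by fact
  let ?H = "B - A ** W"
  have meas: "l k \<in> borel_measurable M" for k
    using assms(6) by (auto simp: iid_sequence_def indep_vars_def)
  have int: "integrable M (l k)" for k
    using binary_vector_integrable_expectation(1)[OF meas assms(7)] .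
  obtain a where a: "p = a *\<^sub>R 1"
    using assms(12) by (auto simp: span_singleton)
  define c :: "real^'n" where "c = (1 - a) *\<^sub>R 1"
  have El: "expectation (l k) = c" for k
    using binary_vector_integrable_expectation(2)[OF meas assms(7)] assms(9) a
    by (simp add: vec_eq_iff c_def)
  \<comment> \<open>\<open>B c = c\<close> and \<open>W c = c\<close>, so the two occurrences of \<open>A c\<close> cancel.\<close>
  have fixpoint: "?H *v c + A *v c = c"
    using row_stochastic_mult_const[OF assms(2)] row_stochastic_mult_const[OF assms(3)]
    by (simp add: c_def matrix_vector_mult_diff_rdistrib flip: matrix_vector_mul_assoc)
  have c: "c \<in> span {1}"
    by (simp add: c_def span_mul span_base)
  have "(\<lambda>k. expectation (process A B W l x0 k)) \<longlonglongrightarrow> c" for x0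
  proof -
    have "expectation (process A B W l x0 k) = c + (((*v) ?H) ^^ k) (x0 - c)" for k
    proof (induction k)
      case 0
      then show ?case by (simp add: prob_space)
    next
      case (Suc k)
      have "expectation (process A B W l x0 (Suc k)) =
          (?H *v c + A *v c) + ?H *v (((*v) ?H) ^^ k) (x0 - c)"
        unfolding process_integrable_expectation(2)[of l, OF int] Suc El
        by (simp add: matrix_vector_right_distrib)
      then show ?case
        by (simp only: fixpoint funpow.simps o_apply)
    qed
    then show ?thesis
      using tendsto_add[OF tendsto_const schur_stable_power_tendsto_0[OF assms(11)], of c "x0 - c"]
      by simp
  qed
  then show ?thesis
    using c process_integrable_expectation(1)[of l, OF int] by blast
qed

end
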